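(* For each $k \in \mathbb{N}$, every (finite) graph $G$ with chromatic number $\chi(G) \ge 7k+1$ contains a subgraph $H$ with both connectivity $\kappa(H) \ge k$ and chromatic number $\chi(H) \ge k$.
   Context: $\chi$ denotes chromatic number and $\kappa$ denotes vertex connectivity. *)

theory Defs
  imports "Graph_Theory.Digraph_Component" "HOL-Library.FuncSet"
begin

text \<open>
  A finite simple undirected graph is a \<^locale>\<open>pair_graph\<close>: finite vertex set, symmetric and
  loop-free set of vertex pairs, an undirected edge being represented by its two orientations.
\<close>

definition proper_colouring :: "'a pair_pre_digraph \<Rightarrow> nat \<Rightarrow> ('a \<Rightarrow> nat) \<Rightarrow> bool" where
  "proper_colouring G n c \<longleftrightarrow>
     c \<in> pverts G \<rightarrow> {..<n} \<and> (\<forall>(u, v) \<in> parcs G. c u \<noteq> c v)"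

definition chromatic_number :: "'a pair_pre_digraph \<Rightarrow> nat" where
  "chromatic_number G = (LEAST n. \<exists>c. proper_colouring G n c)"

text \<open>
  Least number of vertices whose deletion leaves a graph that is disconnected or has at most one
  vertex. The second alternative gives the usual value \<open>n - 1\<close> for the complete graph on \<open>n\<close>
  vertices.
\<close>

definition vertex_connectivity :: "'a pair_pre_digraph \<Rightarrow> nat" where
  "vertex_connectivity G =
     (LEAST n. \<exists>X \<subseteq> pverts G. card X = n \<and>
        (\<not> connected (with_proj G \<restriction> (pverts G - X)) \<or> card (pverts G - X) \<le> 1))"

lemma vertex_connectivity_ge_iff:
  assumes "finite (pverts G)" and "k \<ge> 1"
  shows "vertex_connectivity G \<ge> k \<longleftrightarrow>
    card (pverts G) > k \<and>
    (\<forall>X \<subseteq> pverts G. card X < k \<longrightarrow> connected (with_proj G \<restriction> (pverts G - X)))"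
    (is "_ \<longleftrightarrow> ?R")
proof -
  let ?V = "pverts G"
  define S where "S = (\<lambda>X. \<not> connected (with_proj G \<restriction> (?V - X)) \<or> card (?V - X) \<le> 1)"
  define P where "P = (\<lambda>n. \<exists>X \<subseteq> ?V. card X = n \<and> S X)"
  have kappa: "vertex_connectivity G = (LEAST n. P n)"
    by (simp add: vertex_connectivity_def P_def S_def)
  have "P (card ?V)" unfolding P_def S_def by (intro exI[of _ ?V]) simp
  then have least: "P (LEAST n. P n)" by (rule LeastI)
  have *: "k \<le> (LEAST n. P n) \<longleftrightarrow> (\<forall>X \<subseteq> ?V. card X < k \<longrightarrow> \<not> S X)"
  proof
    assume k: "k \<le> (LEAST n. P n)"
    show "\<forall>X \<subseteq> ?V. card X < k \<longrightarrow> \<not> S X"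
    proof (intro allI impI notI)
      fix X assume X: "X \<subseteq> ?V" "card X < k" "S X"
      then have "P (card X)" unfolding P_def by blast
      then have "(LEAST n. P n) \<le> card X" by (rule Least_le)
      with k X show False by linarith
    qed
  next
    assume "\<forall>X \<subseteq> ?V. card X < k \<longrightarrow> \<not> S X"
    moreover from least obtain X where "X \<subseteq> ?V" "card X = (LEAST n. P n)" "S X"
      using P_def[THEN fun_cong, of "LEAST n. P n"] by auto
    ultimately show "k \<le> (LEAST n. P n)"
      by (metis not_le)
  qed
  have **: "(\<forall>X \<subseteq> ?V. card X < k \<longrightarrow> card (?V - X) > 1) \<longleftrightarrow> card ?V > k"
  proof
    assume all: "\<forall>X \<subseteq> ?V. card X < k \<longrightarrow> card (?V - X) > 1"
    show "card ?V > k"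
    proof (rule ccontr)
      assume "\<not> card ?V > k"
      obtain X where X: "X \<subseteq> ?V" "card X = card ?V - 1"
        by (meson diff_le_self obtain_subset_with_card_n)
      have "card X < k" using X(2) \<open>\<not> card ?V > k\<close> \<open>k \<ge> 1\<close> by linarith
      moreover have "card (?V - X) = card ?V - card X"
        using X(1) assms(1) by (simp add: card_Diff_subset finite_subset)
      moreover have "card (?V - X) > 1" using all X(1) \<open>card X < k\<close> by blast
      ultimately show False using X(2) by linarith
    qed
  next
    assume "card ?V > k"
    show "\<forall>X \<subseteq> ?V. card X < k \<longrightarrow> card (?V - X) > 1"
    proof (intro allI impI)
      fix X assume "X \<subseteq> ?V" "card X < k"
      moreover from this have "card (?V - X) = card ?V - card X"
        using assms(1) by (simp add: card_Diff_subset finite_subset)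
      ultimately show "card (?V - X) > 1" using \<open>card ?V > k\<close> by linarith
    qed
  qed
  have "(\<forall>X \<subseteq> ?V. card X < k \<longrightarrow> \<not> S X) \<longleftrightarrow>
      (\<forall>X \<subseteq> ?V. card X < k \<longrightarrow> card (?V - X) > 1) \<and>
      (\<forall>X \<subseteq> ?V. card X < k \<longrightarrow> connected (with_proj G \<restriction> (?V - X)))"
    unfolding S_def not_le[symmetric] by blast
  then show ?thesis unfolding kappa * ** .
qed

end

theory Submission
  imports Defs
begin

text \<open>
  If no subgraph has connectivity and chromatic number at least \<open>k \<ge> 1\<close>, then every induced
  subgraph is \<open>k\<close>-colourable or is separated by fewer than \<open>k\<close> vertices. By induction, partial
  colourings with \<open>7k\<close> colours extend to the whole graph even if some colours are forbidden at
  some vertices, as long as \<open>k\<close> times the number of precoloured vertices plus the number of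
  forbidden colours, counted over all vertices, is at most \<open>2k\<^sup>2\<close>.

  A vertex with at least \<open>k\<close> forbidden colours may be precoloured. For a separation \<open>(A, S, B)\<close> whose
  side \<open>A\<close> carries at most half of the load, each precoloured vertex of \<open>A\<close> is traded for its colour being
  forbidden at its neighbours in \<open>S\<close>; now colour \<open>S \<union> B\<close>, and then \<open>A \<union> S\<close> with \<open>S\<close> precoloured. If the
  graph is \<open>k\<close>-colourable, averaging gives the \<open>k\<close> classes distinct colours, unused by the
  precolouring, such that at most \<open>k/2\<close> vertices receive a forbidden colour; these get distinct
  fresh colours.
\<close>

section \<open>Colour choice by greedy selection and averaging\<close>

definition proper_on :: "('a \<times> 'a) set \<Rightarrow> 'a set \<Rightarrow> ('a \<Rightarrow> nat) \<Rightarrow> bool" where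
  "proper_on E U f \<longleftrightarrow> (\<forall>u\<in>U. \<forall>v\<in>U. (u, v) \<in> E \<longrightarrow> f u \<noteq> f v)"

lemma exists_distinct_representatives:
  assumes "finite R" and "\<And>v. v \<in> R \<Longrightarrow> card R \<le> card (L v)"
  shows "\<exists>h. inj_on h R \<and> (\<forall>v\<in>R. h v \<in> L v)"
  using assms
proof (induction R rule: finite_induct)
  case empty
  then show ?case by simp
next
  case (insert x R)
  have "card R \<le> card (L v)" if "v \<in> R" for v
    using insert.prems[of v] insert.hyps that by simp
  then obtain h where h: "inj_on h R" "\<forall>v\<in>R. h v \<in> L v"
    using insert.IH by blast
  have "card (h ` R) < card (L x)"
    using insert.prems[of x] insert.hyps card_image_le[OF insert.hyps(1), of h] by simp
  then obtain c where c: "c \<in> L x" "c \<notin> h ` R"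
    using insert.hyps(1) by (metis card_mono finite_imageI leD subsetI)
  have "inj_on (h(x := c)) (insert x R)"
    using h(1) c(2) insert.hyps(2) by (auto simp: inj_on_def)
  moreover have "\<forall>v\<in>insert x R. (h(x := c)) v \<in> L v"
    using h(2) c(1) by auto
  ultimately show ?case by blast
qed

text \<open>The values are picked one at a time. At each pick more than \<open>d\<close> elements of
  \<open>P\<close> are still free; if each of them cost more than a \<open>d\<close>-th of the row
  sum, together they would exceed it.\<close>

lemma exists_cheap_injection:
  fixes b :: "nat \<Rightarrow> 'c \<Rightarrow> nat"
  assumes "finite P" and "m + d \<le> card P"
  shows "\<exists>g. inj_on g {..<m} \<and> g \<in> {..<m} \<rightarrow> P \<and> (\<forall>i<m. d * b i (g i) \<le> (\<Sum>c\<in>P. b i c))"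
  using assms(2)
proof (induction m)
  case 0
  then show ?case by simp
next
  case (Suc m)
  then obtain g where g: "inj_on g {..<m}" "g \<in> {..<m} \<rightarrow> P"
    "\<forall>i<m. d * b i (g i) \<le> (\<Sum>c\<in>P. b i c)"
    by auto
  define Q where "Q = P - g ` {..<m}"
  have "card (g ` {..<m}) \<le> m"
    using card_image_le[of "{..<m}" g] by simp
  then have Q: "d < card Q"
    using Suc.prems diff_card_le_card_Diff[of "g ` {..<m}" P] unfolding Q_def by simp
  have finQ: "finite Q" and QP: "Q \<subseteq> P"
    using assms(1) by (auto simp: Q_def)
  have "\<exists>c\<in>Q. d * b m c \<le> (\<Sum>c\<in>P. b m c)"
  proof (rule ccontr)
    assume "\<not> ?thesis"
    then have *: "(\<Sum>c\<in>P. b m c) < d * b m c" if "c \<in> Q" for c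
      using that by (meson not_le)
    have "card Q * (\<Sum>c\<in>P. b m c) = (\<Sum>c'\<in>Q. \<Sum>c\<in>P. b m c)" by simp
    also have "\<dots> < (\<Sum>c\<in>Q. d * b m c)"
      using * finQ Q by (intro sum_strict_mono) auto
    also have "\<dots> = d * (\<Sum>c\<in>Q. b m c)" by (simp add: sum_distrib_left)
    also have "\<dots> \<le> card Q * (\<Sum>c\<in>P. b m c)"
      using Q QP assms(1) by (intro mult_mono sum_mono2) auto
    finally show False by simp
  qed
  then obtain c where c: "c \<in> Q" "d * b m c \<le> (\<Sum>c\<in>P. b m c)" by blast
  have "inj_on (g(m := c)) {..<Suc m}"
    using g(1) c(1) unfolding Q_def by (auto simp: inj_on_def less_Suc_eq)
  moreover have "g(m := c) \<in> {..<Suc m} \<rightarrow> P"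
    using g(2) c(1) QP by (auto simp: less_Suc_eq)
  moreover have "\<forall>i<Suc m. d * b i ((g(m := c)) i) \<le> (\<Sum>c\<in>P. b i c)"
    using g(3) c(2) by (auto simp: less_Suc_eq)
  ultimately show ?case by blast
qed

lemma colour_avoiding:
  assumes W: "finite W"
    and cls: "cls \<in> W \<rightarrow> {..<k}" "proper_on E W cls"
    and F: "\<And>v. v \<in> W \<Longrightarrow> finite (F v) \<and> card (F v) < 3 * k"
    and F_sum: "(\<Sum>v\<in>W. card (F v)) \<le> 2 * k * k"
    and P: "finite P" "5 * k \<le> card P"
  shows "\<exists>f. f \<in> W \<rightarrow> P \<and> proper_on E W f \<and> (\<forall>v\<in>W. f v \<notin> F v)"
proof (cases "k = 0")
  case True
  then have "W = {}" using cls by auto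
  then show ?thesis by (simp add: proper_on_def)
next
  case False
  define C where "C i = {v\<in>W. cls v = i}" for i
  define b where "b i c = (\<Sum>v\<in>C i. if c \<in> F v then 1 else (0::nat))" for i c
  have finC: "finite (C i)" for i using W by (simp add: C_def)
  have group: "(\<Sum>i<k. \<Sum>v\<in>C i. h v) = (\<Sum>v\<in>W. h v)" for h :: "'a \<Rightarrow> nat"
    unfolding C_def using W cls(1) by (intro sum.group) auto
  have b_sum: "(\<Sum>c\<in>P. b i c) \<le> (\<Sum>v\<in>C i. card (F v))" for i
  proof -
    have "(\<Sum>c\<in>P. b i c) = (\<Sum>v\<in>C i. \<Sum>c\<in>P. if c \<in> F v then 1 else 0)"
      unfolding b_def by (rule sum.swap)
    also have "\<dots> = (\<Sum>v\<in>C i. card (P \<inter> F v))"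
      using P(1) by (simp add: sum.If_cases)
    also have "\<dots> \<le> (\<Sum>v\<in>C i. card (F v))"
      using F by (intro sum_mono card_mono) (auto simp: C_def)
    finally show ?thesis .
  qed
  \<comment> \<open>\<open>b i c\<close> counts the vertices of class \<open>i\<close> that forbid
    \<open>c\<close>. Out of \<open>5 * k\<close> colours, \<open>k\<close> classes leave
    \<open>d = 4 * k\<close>.\<close>
  obtain g where g: "inj_on g {..<k}" "g \<in> {..<k} \<rightarrow> P"
    "\<forall>i<k. 4 * k * b i (g i) \<le> (\<Sum>c\<in>P. b i c)"
    using exists_cheap_injection[OF P(1), of k "4 * k" b] P(2) by auto
  define R where "R = {v\<in>W. g (cls v) \<in> F v}"
  have finR: "finite R" using W by (simp add: R_def)
  have "card R = (\<Sum>v\<in>W. if g (cls v) \<in> F v then 1 else 0)"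
    using W by (simp add: R_def sum.If_cases Int_def)
  also have "\<dots> = (\<Sum>i<k. \<Sum>v\<in>C i. if g (cls v) \<in> F v then 1 else 0)"
    by (simp add: group)
  also have "\<dots> = (\<Sum>i<k. b i (g i))"
    unfolding b_def C_def by (intro sum.cong) auto
  finally have "4 * k * card R = (\<Sum>i<k. 4 * k * b i (g i))"
    by (simp add: sum_distrib_left)
  also have "\<dots> \<le> (\<Sum>i<k. \<Sum>v\<in>C i. card (F v))"
    using g(3) b_sum by (intro sum_mono) (meson lessThan_iff order_trans)
  also have "\<dots> \<le> 2 * k * k"
    using F_sum by (simp add: group)
  \<comment> \<open>The bound k/2 on \<open>card R\<close> is relaxed to \<open>k\<close>, which the
    lists below can afford.\<close>
  finally have "4 * k * card R \<le> 4 * k * k" by (rule order_trans) simp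
  then have cardR: "card R \<le> k"
    using False by simp
  \<comment> \<open>The vertices of \<open>R\<close> get distinct colours that no class uses, so
    their adjacencies need no inspection. More than 5k - k - 3k = k colours remain in each
    list.\<close>
  define L where "L v = P - g ` {..<k} - F v" for v
  have "card R \<le> card (L v)" if "v \<in> R" for v
  proof -
    have "card (g ` {..<k}) \<le> k" using card_image_le[of "{..<k}" g] by simp
    then have "4 * k \<le> card (P - g ` {..<k})"
      using P diff_card_le_card_Diff[of "g ` {..<k}" P] by simp
    moreover have "finite (F v)" "card (F v) < 3 * k" using F that by (auto simp: R_def)
    ultimately show ?thesis
      using cardR diff_card_le_card_Diff[of "F v" "P - g ` {..<k}"] unfolding L_def by linarith
  qed
  then obtain h where h: "inj_on h R" "\<forall>v\<in>R. h v \<in> L v"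
    using exists_distinct_representatives[OF finR] by blast
  define f where "f v = (if v \<in> R then h v else g (cls v))" for v
  have "f \<in> W \<rightarrow> P"
    using h(2) g(2) cls(1) unfolding f_def L_def by auto
  moreover have "f v \<notin> F v" if "v \<in> W" for v
    using h(2) that unfolding f_def L_def R_def by auto
  moreover have "f u \<noteq> f v" if uv: "u \<in> W" "v \<in> W" "(u, v) \<in> E" for u v
  proof -
    have ne: "cls u \<noteq> cls v" and lt: "cls u < k" "cls v < k"
      using cls uv unfolding proper_on_def by auto
    have "u \<noteq> v" using ne by auto
    have "g (cls u) \<noteq> g (cls v)" using g(1) ne lt by (auto simp: inj_on_def)
    moreover have "h u \<noteq> h v" if "u \<in> R" "v \<in> R"
      using h(1) that \<open>u \<noteq> v\<close> by (auto simp: inj_on_def)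
    moreover have "h w \<notin> g ` {..<k}" if "w \<in> R" for w
      using h(2) that by (auto simp: L_def)
    ultimately show ?thesis using lt unfolding f_def
      by (metis imageI lessThan_iff)
  qed
  ultimately show ?thesis unfolding proper_on_def by blast
qed

section \<open>The load of a precolouring\<close>

text \<open>
  The vertices of \<open>X\<close> are precoloured; any other vertex \<open>v\<close> must avoid the colours in \<open>F v\<close>. At the
  rate \<open>k\<close>, forbidding a colour on a separator of size at most \<open>k\<close> is paid for by dropping the
  precoloured vertex that forbids it.
\<close>

definition load :: "nat \<Rightarrow> 'a set \<Rightarrow> ('a \<Rightarrow> nat set) \<Rightarrow> 'a set \<Rightarrow> nat" where
  "load k X F U = (\<Sum>v\<in>U. if v \<in> X then k else card (F v))"

lemma load_union:
  "finite A \<Longrightarrow> finite B \<Longrightarrow> A \<inter> B = {} \<Longrightarrow> load k X F (A \<union> B) = load k X F A + load k X F B"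
  by (simp add: load_def sum.union_disjoint)

lemma load_eq:
  assumes "finite U"
  shows "load k X F U = k * card (U \<inter> X) + (\<Sum>v\<in>U - X. card (F v))"
  unfolding load_def using assms by (simp add: sum.If_cases Diff_eq Collect_neg_eq)

lemma load_precoloured: "U \<subseteq> X \<Longrightarrow> load k X F U = k * card U"
  unfolding load_def by (subst sum.cong[OF refl, of _ _ "\<lambda>_. k"]) auto

lemma card_precoloured_le:
  assumes "finite V" "X \<subseteq> V" "load k X F V \<le> 2 * k * k" "k \<ge> 1"
  shows "card X \<le> 2 * k"
proof -
  have "k * card X \<le> load k X F V"
    using assms(2) by (simp add: load_eq[OF assms(1)] Int_absorb1)
  then have "k * card X \<le> k * (2 * k)"
    using assms(3) by (simp only: mult.assoc mult.left_commute)
  then show ?thesis using assms(4) by simp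
qed

text \<open>At most \<open>2 * k\<close> colours occur on \<open>X\<close>, so at least
  \<open>5 * k\<close> remain. Using only these outside \<open>X\<close> rules out any conflict with
  \<open>X\<close>, and \<open>colour_avoiding\<close> handles the rest.\<close>

lemma precolouring_extends_to_k_colourable:
  assumes V: "finite V" "X \<subseteq> V" and k: "k \<ge> 1"
    and c0: "c0 \<in> X \<rightarrow> {..<7 * k}" "proper_on E X c0"
    and F: "\<And>v. v \<in> V - X \<Longrightarrow> finite (F v) \<and> card (F v) < 3 * k"
    and load: "load k X F V \<le> 2 * k * k"
    and cls: "cls \<in> V \<rightarrow> {..<k}" "proper_on E V cls"
  shows "\<exists>f. (\<forall>v\<in>X. f v = c0 v) \<and> f \<in> V \<rightarrow> {..<7 * k} \<and> proper_on E V f \<and> (\<forall>v\<in>V - X. f v \<notin> F v)"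
proof -
  define P where "P = {..<7 * k} - c0 ` X"
  have finX: "finite X" using V finite_subset by blast
  have "card X \<le> 2 * k" using card_precoloured_le[OF V load k] .
  then have "card (c0 ` X) \<le> 2 * k" using card_image_le[OF finX, of c0] by simp
  then have P: "finite P" "5 * k \<le> card P"
    using diff_card_le_card_Diff[of "c0 ` X" "{..<7 * k}"] finX unfolding P_def by auto
  have "\<exists>f. f \<in> V - X \<rightarrow> P \<and> proper_on E (V - X) f \<and> (\<forall>v\<in>V - X. f v \<notin> F v)"
  proof (rule colour_avoiding[OF _ _ _ F _ P])
    show "(\<Sum>v\<in>V - X. card (F v)) \<le> 2 * k * k"
      using load load_eq[OF V(1), of k X F] by simp
  qed (use V cls in \<open>auto simp: proper_on_def\<close>)
  then obtain f where f: "f \<in> V - X \<rightarrow> P" "proper_on E (V - X) f" "\<forall>v\<in>V - X. f v \<notin> F v"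
    by blast
  define f' where "f' v = (if v \<in> X then c0 v else f v)" for v
  have fresh: "f v \<notin> c0 ` X" "f v < 7 * k" if "v \<in> V - X" for v
    using f(1) that unfolding P_def by auto
  have "proper_on E V f'"
    unfolding proper_on_def
  proof (intro ballI impI)
    fix u v assume uv: "u \<in> V" "v \<in> V" "(u, v) \<in> E"
    show "f' u \<noteq> f' v"
      using uv fresh[of u] fresh[of v] f(2) c0(2) unfolding f'_def proper_on_def
      by (cases "u \<in> X"; cases "v \<in> X") force+
  qed
  moreover have "f' \<in> V \<rightarrow> {..<7 * k}"
    using c0(1) fresh(2) by (auto simp: f'_def)
  ultimately show ?thesis using f(3) by (intro exI[of _ f']) (auto simp: f'_def)
qed

section \<open>Gluing colourings along small separators\<close>

text \<open>\<open>S\<close> may be empty, which covers disconnected graphs. Nonempty sides make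
  \<open>A \<union> S\<close> and \<open>S \<union> B\<close> proper subsets of \<open>U\<close>, as
  the induction requires.\<close>

definition separation :: "('a \<times> 'a) set \<Rightarrow> 'a set \<Rightarrow> 'a set \<Rightarrow> 'a set \<Rightarrow> 'a set \<Rightarrow> bool" where
  "separation E U A S B \<longleftrightarrow> U = A \<union> S \<union> B \<and> A \<inter> S = {} \<and> A \<inter> B = {} \<and> S \<inter> B = {} \<and>
     A \<noteq> {} \<and> B \<noteq> {} \<and> (\<forall>a\<in>A. \<forall>b\<in>B. (a, b) \<notin> E \<and> (b, a) \<notin> E)"

lemma separation_commute: "separation E U A S B \<Longrightarrow> separation E U B S A"
  unfolding separation_def by (intro conjI) blast+

text \<open>The measure has two summands because precolouring a vertex keeps \<open>V\<close> and
  shrinks only \<open>V - X\<close>, whereas both colourings at a separation live on smaller vertex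
  sets with no more uncoloured vertices.\<close>

lemma precolouring_extends:
  fixes E :: "('a \<times> 'a) set"
  assumes E: "sym E" "irrefl E" and k: "k \<ge> 1"
    and split: "\<And>U. U \<subseteq> V0 \<Longrightarrow> (\<exists>c. c \<in> U \<rightarrow> {..<k} \<and> proper_on E U c) \<or>
      (\<exists>A S B. separation E U A S B \<and> card S < k)"
    and "finite V0" "V \<subseteq> V0" "X \<subseteq> V"
    and "c0 \<in> X \<rightarrow> {..<7 * k}" "proper_on E X c0"
    and "\<And>v. v \<in> V - X \<Longrightarrow> finite (F v) \<and> card (F v) < 3 * k"
    and "load k X F V \<le> 2 * k * k"
  shows "\<exists>f. (\<forall>v\<in>X. f v = c0 v) \<and> f \<in> V \<rightarrow> {..<7 * k} \<and> proper_on E V f \<and> (\<forall>v\<in>V - X. f v \<notin> F v)"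
  using assms(6-)
proof (induction "card V + card (V - X)" arbitrary: V X c0 F rule: less_induct)
  case less
  note V = \<open>V \<subseteq> V0\<close> and X = \<open>X \<subseteq> V\<close> and c0 = less.prems(3,4) and F = less.prems(5)
    and load = less.prems(6)
  have finV: "finite V" using V \<open>finite V0\<close> finite_subset by blast
  have finX: "finite X" using X finV finite_subset by blast
  have cardX: "card X \<le> 2 * k" using card_precoloured_le[OF finV X load k] .
  consider (heavy) v where "v \<in> V - X" "k \<le> card (F v)"
    | (base) c where "c \<in> V \<rightarrow> {..<k}" "proper_on E V c"
    \<comment> \<open>With no heavy vertex left, every list has fewer than \<open>k\<close> colours,
      so up to \<open>2 * k\<close> further ones respect the bound \<open>3 * k\<close>.\<close>
    | (sep) A S B where "separation E V A S B" "card S < k" "\<And>v. v \<in> V - X \<Longrightarrow> card (F v) < k"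
    using split[OF V] by (meson not_le)
  then show ?case
  proof cases
    case heavy
    \<comment> \<open>Fewer than 2k + 3k colours are excluded. Since \<open>c\<close> is new to all
      of \<open>X\<close>, the neighbours of \<open>v\<close> do not matter.\<close>
    have "card (c0 ` X \<union> F v) \<le> card (c0 ` X) + card (F v)" by (rule card_Un_le)
    also have "\<dots> < card {..<7 * k}"
      using cardX card_image_le[OF finX, of c0] F[OF heavy(1)] by simp
    finally obtain c where c: "c < 7 * k" "c \<notin> c0 ` X" "c \<notin> F v"
      using card_mono[of "c0 ` X \<union> F v" "{..<7 * k}"] finX F[OF heavy(1)]
      by (metis UnI1 UnI2 finite_UnI finite_imageI leD lessThan_iff subsetI)
    define X' where "X' = insert v X"
    have eq: "V - X = insert v (V - X')" using heavy(1) by (auto simp: X'_def)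
    have "\<exists>f. (\<forall>w\<in>X'. f w = (c0(v := c)) w) \<and> f \<in> V \<rightarrow> {..<7 * k} \<and> proper_on E V f \<and>
        (\<forall>w\<in>V - X'. f w \<notin> F w)"
    proof (rule less.hyps[OF _ V])
      show "card V + card (V - X') < card V + card (V - X)"
        unfolding eq using finV by (simp add: X'_def)
      show "X' \<subseteq> V" using X heavy(1) by (auto simp: X'_def)
      show "c0(v := c) \<in> X' \<rightarrow> {..<7 * k}" using c0 c by (auto simp: X'_def)
      show "proper_on E X' (c0(v := c))"
        using c0(2) c(2) \<open>irrefl E\<close> unfolding proper_on_def X'_def irrefl_def by auto
      show "finite (F w) \<and> card (F w) < 3 * k" if "w \<in> V - X'" for w
        using F[of w] that by (auto simp: X'_def)
      \<comment> \<open>\<open>v\<close> now weighs \<open>k\<close> instead of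
        \<open>card (F v) \<ge> k\<close>.\<close>
      have "load k X' F V \<le> load k X F V"
        unfolding load_def X'_def using heavy by (intro sum_mono) auto
      then show "load k X' F V \<le> 2 * k * k" using load by simp
    qed
    then obtain f where f: "\<forall>w\<in>X'. f w = (c0(v := c)) w" "f \<in> V \<rightarrow> {..<7 * k}" "proper_on E V f"
      "\<forall>w\<in>V - X'. f w \<notin> F w" by blast
    have "\<forall>w\<in>X. f w = c0 w" using f(1) heavy(1) by (auto simp: X'_def)
    moreover have "\<forall>w\<in>V - X. f w \<notin> F w"
      unfolding eq using f(1,4) c(3) by (auto simp: X'_def)
    ultimately show ?thesis using f(2,3) by blast
  next
    case base
    then show ?thesis
      using precolouring_extends_to_k_colourable[OF finV X k c0 F load] by blast
  next
    case sep
    have "\<exists>A B. separation E V A S B \<and> load k X F A \<le> load k X F B"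
      using sep(1) separation_commute nat_le_linear by metis
    then obtain A B where AB: "separation E V A S B" "load k X F A \<le> load k X F B" by blast
    have V_eq: "V = A \<union> (S \<union> B)" and disj: "A \<inter> S = {}" "A \<inter> B = {}" "S \<inter> B = {}"
      and ne: "A \<noteq> {}" "B \<noteq> {}" and no_edge: "\<And>a b. a \<in> A \<Longrightarrow> b \<in> B \<Longrightarrow> (a, b) \<notin> E \<and> (b, a) \<notin> E"
      using AB(1) unfolding separation_def by auto
    have fin: "finite A" "finite S" "finite B" using finV V_eq by auto
    have load_V: "load k X F V = load k X F A + load k X F S + load k X F B"
      unfolding V_eq using fin disj by (simp add: load_union Int_Un_distrib)
    define F' where "F' v = F v \<union> c0 ` {x \<in> X \<inter> A. (x, v) \<in> E}" for v
    have card_forbid: "card (c0 ` {x \<in> X \<inter> A. (x, v) \<in> E}) \<le> card (X \<inter> A)" for v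
      using finX by (intro order_trans[OF card_image_le] card_mono) auto
    have card_F': "card (F' v) \<le> card (F v) + card (X \<inter> A)" for v
      unfolding F'_def using card_forbid[of v] by (intro order_trans[OF card_Un_le]) simp
    have F'_B: "F' v = F v" if "v \<in> B" for v
      unfolding F'_def using no_edge that by auto
    have "\<exists>f. (\<forall>v\<in>X \<inter> (S \<union> B). f v = c0 v) \<and> f \<in> S \<union> B \<rightarrow> {..<7 * k} \<and> proper_on E (S \<union> B) f \<and>
        (\<forall>v\<in>S \<union> B - X \<inter> (S \<union> B). f v \<notin> F' v)"
    proof (rule less.hyps)
      have "card (S \<union> B) < card V"
        using finV ne disj V_eq by (intro psubset_card_mono) auto
      moreover have "card (S \<union> B - X \<inter> (S \<union> B)) \<le> card (V - X)"
        using finV V_eq by (intro card_mono) auto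
      ultimately show "card (S \<union> B) + card (S \<union> B - X \<inter> (S \<union> B)) < card V + card (V - X)" by simp
      show "S \<union> B \<subseteq> V0" "X \<inter> (S \<union> B) \<subseteq> S \<union> B" using V V_eq by auto
      show "c0 \<in> X \<inter> (S \<union> B) \<rightarrow> {..<7 * k}" "proper_on E (X \<inter> (S \<union> B)) c0"
        using c0 by (auto simp: proper_on_def)
      show "finite (F' v) \<and> card (F' v) < 3 * k" if "v \<in> S \<union> B - X \<inter> (S \<union> B)" for v
      proof -
        have v: "v \<in> V - X" using that V_eq by auto
        have "card (X \<inter> A) \<le> 2 * k" using cardX card_mono[OF finX, of "X \<inter> A"] by simp
        then have "card (F' v) < 3 * k" using card_F'[of v] sep(3)[OF v] by linarith
        then show ?thesis using F[OF v] finX by (simp add: F'_def)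
      qed
      \<comment> \<open>Each of the fewer than \<open>k\<close> vertices of \<open>S\<close> gains
        at most \<open>card (X \<inter> A)\<close> forbidden colours. The total is covered by the
        load of \<open>A\<close>, which is dropped.\<close>
      have "load k (X \<inter> (S \<union> B)) F' (S \<union> B) = load k X F' S + load k X F' B"
        using fin disj by (subst load_union[symmetric]) (auto simp: load_def intro!: sum.cong)
      also have "load k X F' B = load k X F B" unfolding load_def using F'_B by (intro sum.cong) auto
      also have "load k X F' S \<le> (\<Sum>v\<in>S. (if v \<in> X then k else card (F v)) + card (X \<inter> A))"
        unfolding load_def using card_F' by (intro sum_mono) auto
      also have "\<dots> = load k X F S + card S * card (X \<inter> A)"
        by (simp add: load_def sum.distrib)
      also have "card S * card (X \<inter> A) \<le> k * card (A \<inter> X)"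
        using sep(2) by (simp add: Int_commute)
      also have "\<dots> \<le> load k X F A" using load_eq[OF fin(1), of k X F] by simp
      finally show "load k (X \<inter> (S \<union> B)) F' (S \<union> B) \<le> 2 * k * k" using load load_V by simp
    qed
    then obtain f where f: "\<forall>v\<in>X \<inter> (S \<union> B). f v = c0 v" "f \<in> S \<union> B \<rightarrow> {..<7 * k}"
      "proper_on E (S \<union> B) f" "\<forall>v\<in>S \<union> B - X \<inter> (S \<union> B). f v \<notin> F' v" by blast
    define c1 where "c1 v = (if v \<in> S then f v else c0 v)" for v
    have c1_X: "c1 v = c0 v" if "v \<in> X" for v using f(1) that by (auto simp: c1_def)
    define Y where "Y = X \<inter> A \<union> S"
    \<comment> \<open>For \<open>s\<close> in \<open>X\<close> the precolouring is already proper;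
      otherwise \<open>F'\<close> has forbidden the colour of \<open>x\<close> at
      \<open>s\<close>.\<close>
    have XS: "c0 x \<noteq> f s" if "x \<in> X \<inter> A" "s \<in> S" "(x, s) \<in> E" for x s
    proof (cases "s \<in> X")
      case True
      then show ?thesis using f(1) c0(2) that by (auto simp: proper_on_def)
    next
      case False
      then show ?thesis using f(4) that by (force simp: F'_def)
    qed
    have "\<exists>h. (\<forall>v\<in>Y. h v = c1 v) \<and> h \<in> A \<union> S \<rightarrow> {..<7 * k} \<and> proper_on E (A \<union> S) h \<and>
        (\<forall>v\<in>A \<union> S - Y. h v \<notin> F v)"
    proof (rule less.hyps)
      have "card (A \<union> S) < card V"
        using finV ne disj V_eq by (intro psubset_card_mono) auto
      moreover have "card (A \<union> S - Y) \<le> card (V - X)"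
        using finV V_eq by (intro card_mono) (auto simp: Y_def)
      ultimately show "card (A \<union> S) + card (A \<union> S - Y) < card V + card (V - X)" by simp
      show "A \<union> S \<subseteq> V0" "Y \<subseteq> A \<union> S" using V V_eq by (auto simp: Y_def)
      show "c1 \<in> Y \<rightarrow> {..<7 * k}"
        using c0(1) f(2) by (auto simp: Y_def c1_def)
      show "proper_on E Y c1"
        unfolding proper_on_def
      proof (intro ballI impI)
        fix u v assume uv: "u \<in> Y" "v \<in> Y" "(u, v) \<in> E"
        have "(v, u) \<in> E" using uv(3) \<open>sym E\<close> by (auto dest: symD)
        then show "c1 u \<noteq> c1 v"
          using uv XS[of u v] XS[of v u] f(3) c0(2) unfolding Y_def c1_def proper_on_def
          by (cases "u \<in> S"; cases "v \<in> S") force+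
      qed
      show "finite (F v) \<and> card (F v) < 3 * k" if "v \<in> A \<union> S - Y" for v
        using F[of v] that V_eq by (auto simp: Y_def)
      \<comment> \<open>The lighter side has load at most \<open>k * k\<close>, and precolouring all
        of \<open>S\<close> adds at most another \<open>k * k\<close>.\<close>
      have "load k Y F (A \<union> S) = load k Y F A + load k Y F S"
        using fin disj by (intro load_union)
      also have "load k Y F A = load k X F A"
        unfolding load_def Y_def using disj by (intro sum.cong) auto
      also have "load k Y F S = k * card S" by (intro load_precoloured) (auto simp: Y_def)
      also have "\<dots> \<le> k * k" using sep(2) by simp
      finally show "load k Y F (A \<union> S) \<le> 2 * k * k" using load load_V AB(2) by simp
    qed
    then obtain h where h: "\<forall>v\<in>Y. h v = c1 v" "h \<in> A \<union> S \<rightarrow> {..<7 * k}"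
      "proper_on E (A \<union> S) h" "\<forall>v\<in>A \<union> S - Y. h v \<notin> F v" by blast
    \<comment> \<open>\<open>h\<close> and \<open>f\<close> agree on \<open>S\<close>, and every
      edge lies inside \<open>A \<union> S\<close> or inside \<open>S \<union> B\<close>.\<close>
    define f' where "f' v = (if v \<in> A then h v else f v)" for v
    have h_S: "h v = f v" if "v \<in> S" for v using h(1) that by (auto simp: Y_def c1_def)
    have f'_AS: "f' v = h v" if "v \<in> A \<union> S" for v using that h_S by (auto simp: f'_def)
    have f'_SB: "f' v = f v" if "v \<in> S \<union> B" for v using that disj by (auto simp: f'_def)
    have "proper_on E V f'"
      unfolding proper_on_def
    proof (intro ballI impI)
      fix u v assume uv: "u \<in> V" "v \<in> V" "(u, v) \<in> E"
      then consider "u \<in> A \<union> S" "v \<in> A \<union> S" | "u \<in> S \<union> B" "v \<in> S \<union> B"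
        using no_edge V_eq by blast
      then show "f' u \<noteq> f' v"
        using f(3) h(3) uv(3) f'_AS f'_SB unfolding proper_on_def by cases metis+
    qed
    moreover have "f' \<in> V \<rightarrow> {..<7 * k}"
      using f(2) h(2) V_eq by (auto simp: f'_def)
    moreover have "f' v = c0 v" if "v \<in> X" for v
    proof (cases "v \<in> A")
      case True
      then show ?thesis using that h(1) c1_X by (simp add: f'_def Y_def)
    next
      case False
      then show ?thesis using that X V_eq f(1) by (auto simp: f'_def)
    qed
    moreover have "f' v \<notin> F v" if "v \<in> V - X" for v
    proof (cases "v \<in> A")
      case True
      then show ?thesis using that h(4) disj by (auto simp: f'_def Y_def)
    next
      case False
      then show ?thesis using that V_eq f(4) by (auto simp: f'_def F'_def)
    qed
    ultimately show ?thesis by blast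
  qed
qed

section \<open>Separations from low connectivity, and the conclusion\<close>

text \<open>One side consists of the vertices reachable from a suitable \<open>u\<close>; symmetry
  of \<open>E\<close> excludes edges in both directions.\<close>

lemma not_connected_imp_separation:
  assumes "sym E" and "W \<noteq> {}"
    and H: "pverts H = U" "parcs H = E \<inter> U \<times> U" and W: "W \<subseteq> U"
    and "\<not> connected (with_proj H \<restriction> W)"
  shows "\<exists>A B. separation E W A {} B"
proof -
  \<comment> \<open>\<open>connected\<close> is strong connectivity of this symmetric closure, which
    adds no arcs as \<open>E\<close> is symmetric.\<close>
  define M where "M = mk_symmetric (with_proj H \<restriction> W)"
  have M: "pverts M = W" "parcs M = E \<inter> W \<times> W"
    using \<open>sym E\<close> W H unfolding M_def mk_symmetric_def by (auto dest: symD)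
  interpret M: pair_wf_digraph M by unfold_locales (auto simp: M)
  \<comment> \<open>The empty digraph is not \<open>strongly_connected\<close>, so
    \<open>W \<noteq> {}\<close> is what yields the pair.\<close>
  obtain u v where uv: "u \<in> W" "v \<in> W" "\<not> u \<rightarrow>\<^sup>*\<^bsub>with_proj M\<^esub> v"
    using assms(2,6) unfolding connected_def M_def[symmetric] strongly_connected_def
    by (auto simp: M)
  define A where "A = {w \<in> W. u \<rightarrow>\<^sup>*\<^bsub>with_proj M\<^esub> w}"
  have no_edge: "(a, b) \<notin> E" if "a \<in> A" "b \<in> W - A" for a b
  proof
    assume "(a, b) \<in> E"
    then have "a \<rightarrow>\<^bsub>with_proj M\<^esub> b" using that by (auto simp: M A_def)
    then have "u \<rightarrow>\<^sup>*\<^bsub>with_proj M\<^esub> b"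
      using that(1) M.reachable_adj_trans[of u a b] by (auto simp: A_def)
    then show False using that by (auto simp: A_def)
  qed
  have "u \<in> A" using uv(1) by (simp add: A_def M)
  moreover have "v \<in> W - A" using uv by (simp add: A_def)
  ultimately have "separation E W A {} (W - A)"
    using no_edge \<open>sym E\<close> unfolding separation_def A_def by (auto dest: symD)
  then show ?thesis by blast
qed

theorem theorem1p1:
  fixes G :: "'a pair_pre_digraph" and k :: nat
  assumes "pair_graph G"
    and "chromatic_number G \<ge> 7 * k + 1"
  shows "\<exists>H :: 'a pair_pre_digraph. pair_graph H \<and> subgraph (with_proj H) (with_proj G) \<and>
           vertex_connectivity H \<ge> k \<and> chromatic_number H \<ge> k"
proof (rule ccontr)
  assume no_H: "\<not> ?thesis"
  interpret G: pair_graph G by fact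
  \<comment> \<open>For \<open>k = 0\<close>, \<open>G\<close> itself would serve as
    \<open>H\<close>.\<close>
  have "subgraph (with_proj G) (with_proj G)"
    by (simp add: subgraph_def compatible_def G.wf_digraph_axioms)
  then have k: "k \<ge> 1"
    using no_H assms(1) by (metis le0 less_one not_le)
  define E where "E = parcs G"
  have E: "sym E" "irrefl E"
    using G.pair_sym_arcs G.pair_no_loops unfolding E_def symmetric_def irrefl_def by fastforce+
  have split: "(\<exists>c. c \<in> U \<rightarrow> {..<k} \<and> proper_on E U c) \<or>
      (\<exists>A S B. separation E U A S B \<and> card S < k)" if U: "U \<subseteq> pverts G" for U
  proof -
    have finU: "finite U" using U G.pair_finite_verts finite_subset by blast
    \<comment> \<open>This injective colouring shows that the \<open>LEAST\<close> in
      \<open>chromatic_number\<close> is attained, and it is a \<open>k\<close>-colouring when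
      \<open>card U \<le> k\<close>.\<close>
    obtain b where "bij_betw b U {0..<card U}"
      using ex_bij_betw_finite_nat[OF finU] by blast
    then have b: "b \<in> U \<rightarrow> {..<card U}" "proper_on E U b"
      using E(2) unfolding proper_on_def bij_betw_def inj_on_def irrefl_def by (fastforce, metis)
    define H where "H = \<lparr>pverts = U, parcs = E \<inter> U \<times> U\<rparr>"
    have H: "pverts H = U" "parcs H = E \<inter> U \<times> U" by (simp_all add: H_def)
    interpret H: pair_graph H
    proof unfold_locales
      show "symmetric (with_proj H)"
        using E(1) unfolding symmetric_def with_proj_simps H sym_def by blast
    qed (use finU E(2) in \<open>auto simp: H irrefl_def\<close>)
    have "subgraph (with_proj H) (with_proj G)"
      using U by (auto simp: subgraph_def compatible_def G.wf_digraph_axioms H.wf_digraph_axioms H E_def)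
    then consider "chromatic_number H < k" | "vertex_connectivity H < k"
      using no_H H.pair_graph_axioms not_le by blast
    then show ?thesis
    proof cases
      case 1
      have "proper_colouring H (card U) b"
        using b unfolding proper_colouring_def proper_on_def H by auto
      then have "\<exists>c. proper_colouring H (chromatic_number H) c"
        unfolding chromatic_number_def by (intro LeastI) auto
      then obtain c where "proper_colouring H (chromatic_number H) c" by blast
      then have "c \<in> U \<rightarrow> {..<k} \<and> proper_on E U c"
        using 1 unfolding proper_colouring_def proper_on_def H
        by (auto simp: Pi_iff intro: less_trans)
      then show ?thesis by blast
    next
      case 2
      \<comment> \<open>Low connectivity has two causes: too few vertices, where \<open>b\<close>
        serves, or a genuine small separator.\<close>
      then have "card U \<le> k \<or>
          (\<exists>S\<subseteq>U. card S < k \<and> k < card U \<and> \<not> connected (with_proj H \<restriction> (U - S)))"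
        using vertex_connectivity_ge_iff[of H k] finU k unfolding H by (meson not_le)
      then show ?thesis
      proof (elim disjE exE conjE)
        assume le: "card U \<le> k"
        then have "b \<in> U \<rightarrow> {..<k}" using b(1) by (auto simp: Pi_iff intro: less_le_trans)
        then show ?thesis using b(2) by blast
      next
        fix S assume S: "S \<subseteq> U" "card S < k" "k < card U" "\<not> connected (with_proj H \<restriction> (U - S))"
        have "U - S \<noteq> {}" using S card_mono[of S U] finU finite_subset[OF S(1)] by auto
        then obtain A B where "separation E (U - S) A {} B"
          using not_connected_imp_separation[OF E(1) _ H _ S(4)] by blast
        then have "separation E U A S B"
          using S(1) unfolding separation_def by (intro conjI) blast+
        then show ?thesis using S(2) by blast
      qed
    qed
  qed
  \<comment> \<open>Nothing is precoloured or forbidden, so the load is 0.\<close>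
  have "\<exists>f. (\<forall>v\<in>{}. f v = 0) \<and> f \<in> pverts G \<rightarrow> {..<7 * k} \<and> proper_on E (pverts G) f \<and>
      (\<forall>v\<in>pverts G - {}. f v \<notin> {})"
    using precolouring_extends[OF E k split G.pair_finite_verts order_refl,
        of "{}" "\<lambda>_. 0" "\<lambda>_. {}"] k
    by (simp add: proper_on_def load_def)
  then obtain f where "f \<in> pverts G \<rightarrow> {..<7 * k}" "proper_on E (pverts G) f" by blast
  then have "proper_colouring G (7 * k) f"
    unfolding proper_colouring_def proper_on_def E_def
    by (auto dest: G.in_arcsD1 G.in_arcsD2)
  then have "chromatic_number G \<le> 7 * k"
    unfolding chromatic_number_def by (intro Least_le) blast
  then show False using assms(2) by simp
qed

end
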